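(* Let $\mathfrak{a}=\mathfrak{a}(\mathfrak{g};\kappa,\lambda,s)$ be a Lie affgebra over $\mathbb{F}$ and $\delta=\lambda-\kappa$. Let $\omega:\mathfrak{a}\times\mathfrak{a}\to\mathbb{F}$ be a bi-affine map. Then $\omega$ satisfies, for all $a,b,c\in\mathfrak{a}$, $$\omega(a,b)-\omega(a,a)+\omega(b,a)=\omega(b,b),$$ $$\omega(a,\{b,c\})-\omega(a,\{a,a\})+\omega(b,\{c,a\})-\omega(b,\{b,b\})+\omega(c,\{a,b\})=\omega(c,\{c,c\}),$$ if and only if there exist a 2-cocycle $\pi$ on $\mathfrak{g}$, linear forms $\rho,\sigma$ on $\mathfrak{g}$, and $\tau\in\mathbb{F}$ such that, for all $a,b\in\mathfrak{g}$, $$\omega(a,b)=\pi(a,b)+\rho(a)+\sigma(b)+\tau \quad\text{and}\quad \sigma([a,b])=\pi(a,\delta(b))+\pi(\lambda(a),b).$$ Furthermore, in this case $\mathfrak{a}(\omega)\cong\mathfrak{a}(\mathfrak{g}(\pi);\hat\kappa,\hat\lambda,\hat s)$ as Lie affgebras, where, for all $a\in\mathfrak g$, $\alpha\in\mathbb F$, $$\hat\kappa(a+\alpha z)=\kappa(a)+(\rho(a)+\sigma(a))z,\qquad \hat\lambda(a+\alpha z)=\lambda(a)+\sigma(a)z,\qquad \hat s=s+\tau z.$$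
   Context: $\mathbb{F}$ is a field of characteristic different from 2. For a Lie algebra $\mathfrak{g}$ over $\mathbb{F}$, linear endomorphisms $\kappa,\lambda$ of $\mathfrak{g}$ with $\lambda([a,b])=[\lambda(a),b]-[a,\kappa(b)]+[a,\lambda(b)]$ for all $a,b\in\mathfrak{g}$, and $s\in\mathfrak{g}$, $\mathfrak{a}(\mathfrak{g};\kappa,\lambda,s)$ denotes the Lie affgebra which is the vector space $\mathfrak{g}$ viewed as an affine space ($\langle a,b,c\rangle=a-b+c$, $\alpha\triangleright_a b=(1-\alpha)a+\alpha b$) with affine Lie bracket $\{a,b\}=[a,b]+\kappa(a)+\lambda(b-a)+s$. In general, a Lie affgebra is an affine space with a bi-affine bracket satisfying $\{a,b\}-\{a,a\}+\{b,a\}=\{b,b\}$ and $\{a,\{b,c\}\}-\{a,\{a,a\}\}+\{b,\{c,a\}\}-\{b,\{b,b\}\}+\{c,\{a,b\}\}=\{c,\{c,c\}\}$. Homomorphisms of Lie affgebras are affine maps preserving brackets. Bi-affine means affine in each argument (on a vector space: linear plus constant). For $\omega$ bi-affine satisfying the two displayed conditions, $\mathfrak{a}(\omega)$ denotes the Lie affgebra on the product affine space $\mathfrak{a}\times\mathbb{F}$ with bracket $\{(a,\alpha),(b,\beta)\}=(\{a,b\},\omega(a,b))$. A 2-cocycle on $\mathfrak{g}$ is an antisymmetric bilinear form $\pi:\mathfrak{g}\times\mathfrak{g}\to\mathbb{F}$ with $\pi(a,[b,c])+\pi(b,[c,a])+\pi(c,[a,b])=0$ for all $a,b,c$. The central extension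 $\mathfrak{g}(\pi)$ is the vector space $\mathfrak{g}\oplus\mathbb{F}z$ with Lie bracket $[a+\alpha z,b+\beta z]=[a,b]+\pi(a,b)z$. *)

theory Defs
  imports "HOL-Analysis.Product_Vector"
begin

section \<open>Lie algebras, 2-cocycles and central extensions\<close>

text \<open>Vector spaces over the field \<open>'f\<close> are given, as in \<^theory>\<open>HOL.Vector_Spaces\<close>, by a scalar
  multiplication on a whole type. Forms take values in \<open>'f\<close>, with scalar multiplication \<open>(*)\<close>.\<close>

definition bilinear_map ::
  "('f::field \<Rightarrow> 'a::ab_group_add \<Rightarrow> 'a) \<Rightarrow> ('f \<Rightarrow> 'b::ab_group_add \<Rightarrow> 'b) \<Rightarrow> ('a \<Rightarrow> 'a \<Rightarrow> 'b) \<Rightarrow> bool"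
  where "bilinear_map s1 s2 B \<longleftrightarrow>
    (\<forall>a. Vector_Spaces.linear s1 s2 (\<lambda>b. B a b)) \<and> (\<forall>b. Vector_Spaces.linear s1 s2 (\<lambda>a. B a b))"

definition linear_form :: "('f::field \<Rightarrow> 'a::ab_group_add \<Rightarrow> 'a) \<Rightarrow> ('a \<Rightarrow> 'f) \<Rightarrow> bool"
  where "linear_form smul f \<longleftrightarrow> Vector_Spaces.linear smul (*) f"

locale lie_algebra = vector_space smul
  for smul :: "'f::field \<Rightarrow> 'a::ab_group_add \<Rightarrow> 'a" +
  fixes lie :: "'a \<Rightarrow> 'a \<Rightarrow> 'a"
  assumes lie_bilinear: "bilinear_map smul smul lie"
    and lie_self: "lie a a = 0"
    and lie_jacobi: "lie a (lie b c) + lie b (lie c a) + lie c (lie a b) = 0"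

definition two_cocycle ::
  "('f::field \<Rightarrow> 'a::ab_group_add \<Rightarrow> 'a) \<Rightarrow> ('a \<Rightarrow> 'a \<Rightarrow> 'a) \<Rightarrow> ('a \<Rightarrow> 'a \<Rightarrow> 'f) \<Rightarrow> bool"
  where "two_cocycle smul lie \<pi> \<longleftrightarrow> bilinear_map smul (*) \<pi> \<and>
    (\<forall>a b. \<pi> b a = - \<pi> a b) \<and>
    (\<forall>a b c. \<pi> a (lie b c) + \<pi> b (lie c a) + \<pi> c (lie a b) = 0)"

text \<open>The pair \<open>(a, \<alpha>)\<close> stands for \<open>a + \<alpha>z\<close>.\<close>

definition central_scale ::
  "('f::field \<Rightarrow> 'a::ab_group_add \<Rightarrow> 'a) \<Rightarrow> 'f \<Rightarrow> 'a \<times> 'f \<Rightarrow> 'a \<times> 'f"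
  where "central_scale smul = module_prod.scale smul (*)"

definition central_lie ::
  "('a::ab_group_add \<Rightarrow> 'a \<Rightarrow> 'a) \<Rightarrow> ('a \<Rightarrow> 'a \<Rightarrow> 'f::field) \<Rightarrow> 'a \<times> 'f \<Rightarrow> 'a \<times> 'f \<Rightarrow> 'a \<times> 'f"
  where "central_lie lie \<pi> = (\<lambda>(a, \<alpha>) (b, \<beta>). (lie a b, \<pi> a b))"


section \<open>Affine spaces\<close>

text \<open>\<open>tern A a b c\<close> is \<open>\<langle>a,b,c\<rangle>\<close> and \<open>act A \<alpha> a b\<close> is \<open>\<alpha> \<triangleright>\<^sub>a b\<close>. An affine space is an
  abelian heap with an action of the field satisfying the axioms below; as the points form a whole
  type, it is nonempty.\<close>

record ('f, 'p) affine_space =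
  tern :: "'p \<Rightarrow> 'p \<Rightarrow> 'p \<Rightarrow> 'p"
  act :: "'f \<Rightarrow> 'p \<Rightarrow> 'p \<Rightarrow> 'p"

definition is_affine_space :: "('f::field, 'p, 'm) affine_space_scheme \<Rightarrow> bool"
  where "is_affine_space A \<longleftrightarrow>
    (\<forall>a b c d e. tern A (tern A a b c) d e = tern A a b (tern A c d e)) \<and>
    (\<forall>a b. tern A a a b = b \<and> tern A b a a = b) \<and>
    (\<forall>a b c. tern A a b c = tern A c b a) \<and>
    (\<forall>\<alpha> \<beta> \<gamma> a b. act A (\<alpha> - \<beta> + \<gamma>) a b = tern A (act A \<alpha> a b) (act A \<beta> a b) (act A \<gamma> a b)) \<and>
    (\<forall>\<alpha> a b c d. act A \<alpha> a (tern A b c d) = tern A (act A \<alpha> a b) (act A \<alpha> a c) (act A \<alpha> a d)) \<and>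
    (\<forall>\<alpha> \<beta> a b. act A \<alpha> a (act A \<beta> a b) = act A (\<alpha> * \<beta>) a b) \<and>
    (\<forall>a b. act A 0 a b = a \<and> act A 1 a b = b) \<and>
    (\<forall>\<alpha> a b c. act A \<alpha> a b = tern A (act A \<alpha> c b) (act A \<alpha> c a) a)"

definition affine_map ::
  "('f::field, 'p, 'm) affine_space_scheme \<Rightarrow> ('f, 'q, 'n) affine_space_scheme \<Rightarrow> ('p \<Rightarrow> 'q) \<Rightarrow> bool"
  where "affine_map A B f \<longleftrightarrow>
    (\<forall>a b c. f (tern A a b c) = tern B (f a) (f b) (f c)) \<and>
    (\<forall>\<alpha> a b. f (act A \<alpha> a b) = act B \<alpha> (f a) (f b))"

definition biaffine_map ::
  "('f::field, 'p, 'm) affine_space_scheme \<Rightarrow> ('f, 'q, 'n) affine_space_scheme \<Rightarrow> ('p \<Rightarrow> 'p \<Rightarrow> 'q) \<Rightarrow> bool"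
  where "biaffine_map A B \<omega> \<longleftrightarrow>
    (\<forall>a. affine_map A B (\<lambda>b. \<omega> a b)) \<and> (\<forall>b. affine_map A B (\<lambda>a. \<omega> a b))"

definition affine_of_vector_space ::
  "('f::field \<Rightarrow> 'a::ab_group_add \<Rightarrow> 'a) \<Rightarrow> ('f, 'a) affine_space"
  where "affine_of_vector_space smul =
    \<lparr>tern = (\<lambda>a b c. a - b + c), act = (\<lambda>\<alpha> a b. smul (1 - \<alpha>) a + smul \<alpha> b)\<rparr>"

definition field_affine :: "('f::field, 'f) affine_space"
  where "field_affine = affine_of_vector_space (*)"

definition product_affine ::
  "('f::field, 'p, 'm) affine_space_scheme \<Rightarrow> ('f, 'q, 'n) affine_space_scheme \<Rightarrow> ('f, 'p \<times> 'q) affine_space"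
  where "product_affine A B =
    \<lparr>tern = (\<lambda>(a, x) (b, y) (c, z). (tern A a b c, tern B x y z)),
     act = (\<lambda>\<alpha> (a, x) (b, y). (act A \<alpha> a b, act B \<alpha> x y))\<rparr>"


section \<open>Lie affgebras\<close>

record ('f, 'p) affgebra = "('f, 'p) affine_space" +
  brk :: "'p \<Rightarrow> 'p \<Rightarrow> 'p"

text \<open>The right-hand sides are the alternating sums \<open>x - y + z\<close> and \<open>x - y + z - u + v\<close> in a heap.\<close>

definition lie_affgebra :: "('f::field, 'p, 'm) affgebra_scheme \<Rightarrow> bool"
  where "lie_affgebra A \<longleftrightarrow>
    is_affine_space A \<and> biaffine_map A A (brk A) \<and>
    (\<forall>a b. brk A b b = tern A (brk A a b) (brk A a a) (brk A b a)) \<and>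
    (\<forall>a b c. brk A c (brk A c c) =
      tern A (tern A (brk A a (brk A b c)) (brk A a (brk A a a)) (brk A b (brk A c a)))
        (brk A b (brk A b b)) (brk A c (brk A a b)))"

definition affgebra_hom ::
  "('f::field, 'p, 'm) affgebra_scheme \<Rightarrow> ('f, 'q, 'n) affgebra_scheme \<Rightarrow> ('p \<Rightarrow> 'q) \<Rightarrow> bool"
  where "affgebra_hom A B f \<longleftrightarrow>
    affine_map A B f \<and> (\<forall>a b. f (brk A a b) = brk B (f a) (f b))"

definition lie_affgebra_isomorphic ::
  "('f::field, 'p, 'm) affgebra_scheme \<Rightarrow> ('f, 'q, 'n) affgebra_scheme \<Rightarrow> bool"
  where "lie_affgebra_isomorphic A B \<longleftrightarrow>
    lie_affgebra A \<and> lie_affgebra B \<and> (\<exists>f. affgebra_hom A B f \<and> bij f)"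

definition lie_affgebra_data ::
  "('f::field \<Rightarrow> 'a::ab_group_add \<Rightarrow> 'a) \<Rightarrow> ('a \<Rightarrow> 'a \<Rightarrow> 'a) \<Rightarrow> ('a \<Rightarrow> 'a) \<Rightarrow> ('a \<Rightarrow> 'a) \<Rightarrow> bool"
  where "lie_affgebra_data smul lie \<kappa> lam \<longleftrightarrow>
    lie_algebra smul lie \<and>
    Vector_Spaces.linear smul smul \<kappa> \<and> Vector_Spaces.linear smul smul lam \<and>
    (\<forall>a b. lam (lie a b) = lie (lam a) b - lie a (\<kappa> b) + lie a (lam b))"

definition affgebra_of ::
  "('f::field \<Rightarrow> 'a::ab_group_add \<Rightarrow> 'a) \<Rightarrow> ('a \<Rightarrow> 'a \<Rightarrow> 'a) \<Rightarrow> ('a \<Rightarrow> 'a) \<Rightarrow> ('a \<Rightarrow> 'a) \<Rightarrow> 'a \<Rightarrow> ('f, 'a) affgebra"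
  where "affgebra_of smul lie \<kappa> lam s =
    affine_space.extend (affine_of_vector_space smul)
      (affgebra.fields (\<lambda>a b. lie a b + \<kappa> a + lam (b - a) + s))"

definition affgebra_cocycle_conditions ::
  "('f::field, 'p, 'm) affgebra_scheme \<Rightarrow> ('p \<Rightarrow> 'p \<Rightarrow> 'f) \<Rightarrow> bool"
  where "affgebra_cocycle_conditions A \<omega> \<longleftrightarrow>
    (\<forall>a b. \<omega> a b - \<omega> a a + \<omega> b a = \<omega> b b) \<and>
    (\<forall>a b c. \<omega> a (brk A b c) - \<omega> a (brk A a a) + \<omega> b (brk A c a) - \<omega> b (brk A b b)
       + \<omega> c (brk A a b) = \<omega> c (brk A c c))"

definition affgebra_extension ::
  "('f::field, 'p, 'm) affgebra_scheme \<Rightarrow> ('p \<Rightarrow> 'p \<Rightarrow> 'f) \<Rightarrow> ('f, 'p \<times> 'f) affgebra"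
  where "affgebra_extension A \<omega> =
    affine_space.extend (product_affine A field_affine)
      (affgebra.fields (\<lambda>(a, \<alpha>) (b, \<beta>). (brk A a b, \<omega> a b)))"


section \<open>Decompositions of bi-affine maps\<close>

text \<open>The name \<open>lam\<close> stands for \<open>\<lambda>\<close>; the definition is meant for \<open>\<delta> = lam - \<kappa>\<close>.\<close>

definition cocycle_decomposition ::
  "('f::field \<Rightarrow> 'a::ab_group_add \<Rightarrow> 'a) \<Rightarrow> ('a \<Rightarrow> 'a \<Rightarrow> 'a) \<Rightarrow> ('a \<Rightarrow> 'a) \<Rightarrow> ('a \<Rightarrow> 'a) \<Rightarrow>
    ('a \<Rightarrow> 'a \<Rightarrow> 'f) \<Rightarrow> ('a \<Rightarrow> 'a \<Rightarrow> 'f) \<Rightarrow> ('a \<Rightarrow> 'f) \<Rightarrow> ('a \<Rightarrow> 'f) \<Rightarrow> 'f \<Rightarrow> bool"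
  where "cocycle_decomposition smul lie lam \<delta> \<omega> \<pi> \<rho> \<sigma> \<tau> \<longleftrightarrow>
    two_cocycle smul lie \<pi> \<and> linear_form smul \<rho> \<and> linear_form smul \<sigma> \<and>
    (\<forall>a b. \<omega> a b = \<pi> a b + \<rho> a + \<sigma> b + \<tau> \<and> \<sigma> (lie a b) = \<pi> a (\<delta> b) + \<pi> (lam a) b)"

end

theory Submission
  imports Defs
begin

text \<open>
  Expanding a bi-affine form at the origin gives \<open>\<omega> a b = \<pi> a b + \<rho> a + \<sigma> b + \<tau>\<close> with \<open>\<pi>\<close> bilinear and
  \<open>\<rho>\<close>, \<open>\<sigma>\<close> linear (\<open>biaffine_form_decomposition\<close>), so the question is only what the two cocycle
  conditions say about these coefficients. The linear and constant parts cancel from the first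
  condition, which for \<open>b = 0\<close> becomes \<open>\<pi> a a = 0\<close>. With \<open>F a b = \<sigma> (lie a b) - \<pi> a (\<delta> b) - \<pi> (lam a) b\<close>,
  the second one becomes \<open>\<Sum> \<pi> a (lie b c) + \<Sum> F a b = \<Sum> \<pi> a (\<kappa> a)\<close>, with cyclic sums. The three kinds of
  terms involve three, two and one of the variables \<open>a\<close>, \<open>b\<close>, \<open>c\<close>, so they are separated by setting
  first two and then one of the variables to zero: all three sums vanish, which is the cocycle identity together with \<open>F = 0\<close>
  (\<open>cocycle_decomposition_of_cocycle_conditions\<close>).

  The converse needs no second computation. Given a decomposition, the equation \<open>F = 0\<close> is the
  central component of the compatibility between the extended maps and the bracket of \<open>\<gg>(\<pi>)\<close>, so
  the extended maps define a Lie affgebra on \<open>\<gg>(\<pi>)\<close>; and this affgebra is not merely isomorphic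
  to the extension by \<open>\<omega>\<close>, it is the same structure on the set of pairs
  (\<open>affgebra_extension_eq_affgebra_of_central_extension\<close>). Hence the extension is a Lie affgebra, and
  the cocycle conditions for \<open>\<omega>\<close> are the central components of its axioms
  (\<open>cocycle_conditions_of_lie_affgebra_extension\<close>). Characteristic different from two enters once:
  an antisymmetric \<open>\<pi>\<close> has to be alternating for \<open>\<gg>(\<pi>)\<close> to be a Lie algebra.
\<close>

section \<open>Linear and affine maps\<close>

lemma linear_map_simps:
  assumes "Vector_Spaces.linear s1 s2 f"
  shows "f (x + y) = f x + f y" "f (x - y) = f x - f y" "f (- x) = - f x" "f 0 = 0"
    "f (s1 c x) = s2 c (f x)"
proof -
  interpret Vector_Spaces.linear s1 s2 f by fact
  show "f (x + y) = f x + f y" "f (x - y) = f x - f y" "f (- x) = - f x" "f 0 = 0"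
    "f (s1 c x) = s2 c (f x)"
    by (rule add diff neg zero scale)+
qed

lemma bilinear_map_simps:
  assumes "bilinear_map s1 s2 B"
  shows "B (x + y) z = B x z + B y z" "B (x - y) z = B x z - B y z" "B (- x) z = - B x z"
    "B 0 z = 0" "B (s1 c x) z = s2 c (B x z)"
    "B z (x + y) = B z x + B z y" "B z (x - y) = B z x - B z y" "B z (- x) = - B z x"
    "B z 0 = 0" "B z (s1 c x) = s2 c (B z x)"
  using assms linear_map_simps[of s1 s2 "B z"] linear_map_simps[of s1 s2 "\<lambda>a. B a z"]
  unfolding bilinear_map_def by auto

lemma field_vector_space: "vector_space ((*) :: 'f::field \<Rightarrow> 'f \<Rightarrow> 'f)"
  by unfold_locales (auto simp: algebra_simps)

lemma lie_algebra_identities: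
  assumes "lie_algebra smul lie"
  shows "vector_space smul" "bilinear_map smul smul lie" "lie a a = 0"
    "lie a (lie b c) + lie b (lie c a) + lie c (lie a b) = 0" "lie b a = - lie a b"
proof -
  interpret lie_algebra smul lie by fact
  show "vector_space smul" by unfold_locales
  show B: "bilinear_map smul smul lie" by (rule lie_bilinear)
  show "lie a a = 0" by (rule lie_self)
  show "lie a (lie b c) + lie b (lie c a) + lie c (lie a b) = 0" by (rule lie_jacobi)
  \<comment> \<open>Antisymmetry is the polarization of \<open>lie x x = 0\<close>.\<close>
  have "lie a a + lie b a + (lie a b + lie b b) = 0"
    using lie_self[of "a + b"] by (simp only: bilinear_map_simps(1,6)[OF B])
  then show "lie b a = - lie a b" by (simp add: lie_self eq_neg_iff_add_eq_0)
qed

text \<open>Affine maps are the linear maps up to a constant: subtraction of the value at \<open>0\<close> turns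
  \<open>a - 0 + b\<close> into addition and the action based at \<open>0\<close> into scalar multiplication.\<close>

lemma affine_form_linear_part:
  assumes V: "vector_space smul"
    and f: "affine_map (affine_of_vector_space smul) field_affine f"
  shows "linear_form smul (\<lambda>a. f a - f 0)"
proof -
  interpret vector_space smul by fact
  have t: "f (a - b + c) = f a - f b + f c" for a b c
    using f by (simp add: affine_map_def field_affine_def affine_of_vector_space_def)
  have m: "f (smul (1 - \<alpha>) a + smul \<alpha> b) = (1 - \<alpha>) * f a + \<alpha> * f b" for \<alpha> a b
    using f by (simp add: affine_map_def field_affine_def affine_of_vector_space_def)
  have "f (a + b) - f 0 = (f a - f 0) + (f b - f 0)" for a b
    using t[of a 0 b] by simp
  moreover have "f (smul \<alpha> a) - f 0 = \<alpha> * (f a - f 0)" for \<alpha> a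
    using m[of \<alpha> 0 a] by (simp add: algebra_simps)
  ultimately show ?thesis
    by (simp add: linear_form_def Vector_Spaces.linear_iff V field_vector_space)
qed

text \<open>The second-order Taylor expansion at the origin: \<open>\<pi>\<close> is the mixed difference of \<open>\<omega>\<close>.\<close>

lemma biaffine_form_decomposition:
  fixes smul :: "'f::field \<Rightarrow> 'a::ab_group_add \<Rightarrow> 'a"
  assumes V: "vector_space smul"
    and W: "biaffine_map (affine_of_vector_space smul) field_affine \<omega>"
  obtains \<pi> \<rho> \<sigma> \<tau> where "bilinear_map smul (*) \<pi>" "linear_form smul \<rho>" "linear_form smul \<sigma>"
    "\<And>a b. \<omega> a b = \<pi> a b + \<rho> a + \<sigma> b + \<tau>"
proof
  define \<rho> where "\<rho> = (\<lambda>a. \<omega> a 0 - \<omega> 0 0)"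
  define \<sigma> where "\<sigma> = (\<lambda>b. \<omega> 0 b - \<omega> 0 0)"
  define \<pi> where "\<pi> = (\<lambda>a b. \<omega> a b - \<omega> a 0 - \<omega> 0 b + \<omega> 0 0)"
  have r: "linear_form smul (\<lambda>a. \<omega> a b - \<omega> 0 b)" for b
    using W affine_form_linear_part[OF V, of "\<lambda>a. \<omega> a b"]
    by (simp add: biaffine_map_def)
  have l: "linear_form smul (\<lambda>b. \<omega> a b - \<omega> a 0)" for a
    using W affine_form_linear_part[OF V, of "\<omega> a"]
    by (simp add: biaffine_map_def)
  show "linear_form smul \<rho>" "linear_form smul \<sigma>"
    unfolding \<rho>_def \<sigma>_def by (rule r l)+
  have "Vector_Spaces.linear smul (*) (\<lambda>b. \<pi> a b)" for a
    using l[of a] l[of 0] unfolding linear_form_def Vector_Spaces.linear_iff \<pi>_def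
    by (auto simp: V field_vector_space algebra_simps)
  moreover have "Vector_Spaces.linear smul (*) (\<lambda>a. \<pi> a b)" for b
    using r[of b] r[of 0] unfolding linear_form_def Vector_Spaces.linear_iff \<pi>_def
    by (auto simp: V field_vector_space algebra_simps)
  ultimately show "bilinear_map smul (*) \<pi>" by (simp add: bilinear_map_def)
  show "\<omega> a b = \<pi> a b + \<rho> a + \<sigma> b + \<omega> 0 0" for a b
    by (simp add: \<pi>_def \<rho>_def \<sigma>_def)
qed

lemma vector_space_is_affine_space:
  assumes "vector_space smul"
  shows "is_affine_space (affine_of_vector_space smul)"
proof -
  interpret vector_space smul by fact
  show ?thesis
    by (simp add: is_affine_space_def affine_of_vector_space_def algebra_simps)
qed

section \<open>The Lie affgebra of a Lie algebra with compatible endomorphisms\<close>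

lemma affgebra_of_simps:
  "tern (affgebra_of smul lie \<kappa> lam s) a b c = a - b + c"
  "act (affgebra_of smul lie \<kappa> lam s) \<alpha> a b = smul (1 - \<alpha>) a + smul \<alpha> b"
  "brk (affgebra_of smul lie \<kappa> lam s) a b = lie a b + \<kappa> a + lam (b - a) + s"
  by (simp_all add: affgebra_of_def affine_of_vector_space_def affine_space.defs affgebra.defs)

text \<open>Affine notions see only the underlying affine space, not the bracket.\<close>

lemma affgebra_of_underlying_affine_space:
  "is_affine_space (affgebra_of smul lie \<kappa> lam s) \<longleftrightarrow> is_affine_space (affine_of_vector_space smul)"
  "biaffine_map (affgebra_of smul lie \<kappa> lam s) B \<omega> \<longleftrightarrow> biaffine_map (affine_of_vector_space smul) B \<omega>"
  by (simp_all add: is_affine_space_def biaffine_map_def affine_map_def affgebra_of_simps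
      affine_of_vector_space_def)

text \<open>The compatibility condition for \<open>a = b\<close> reads \<open>lie a (\<kappa> a) = 0\<close>, because \<open>lie (lam a) a\<close> cancels
  \<open>lie a (lam a)\<close>. This is the quadratic term of \<open>brk A a (brk A a a)\<close>. In the rest of
  the affine Jacobi identity, compatibility cancels the terms that are quadratic in the variables
  and the Jacobi identity the cubic ones; the affine-linear terms cancel in the cyclic sum.\<close>

lemma lie_affgebra_affgebra_of:
  assumes "lie_affgebra_data smul lie \<kappa> lam"
  shows "lie_affgebra (affgebra_of smul lie \<kappa> lam s)"
proof -
  have L: "lie_algebra smul lie" and K: "Vector_Spaces.linear smul smul \<kappa>"
    and M: "Vector_Spaces.linear smul smul lam"
    and compat: "\<And>a b. lam (lie a b) = lie (lam a) b - lie a (\<kappa> b) + lie a (lam b)"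
    using assms by (auto simp: lie_affgebra_data_def)
  interpret vector_space smul by (rule lie_algebra_identities(1)[OF L])
  note B = bilinear_map_simps[OF lie_algebra_identities(2)[OF L]]
  note self = lie_algebra_identities(3)[OF L]
  note lin = linear_map_simps[OF K] linear_map_simps[OF M]
  have skew: "lie b a = - lie a b" for a b by (rule lie_algebra_identities(5)[OF L])
  have kappa0: "lie a (\<kappa> a) = 0" for a
    using compat[of a a] skew[of a "lam a"] by (simp add: self lin)
  let ?A = "affgebra_of smul lie \<kappa> lam s"
  have "biaffine_map ?A ?A (brk ?A)"
    by (simp add: biaffine_map_def affine_map_def affgebra_of_simps lin B algebra_simps)
  moreover have "brk ?A b b = tern ?A (brk ?A a b) (brk ?A a a) (brk ?A b a)" for a b
    using skew[of a b] by (simp add: affgebra_of_simps lin B self algebra_simps)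
  moreover have "brk ?A c (brk ?A c c) =
      tern ?A (tern ?A (brk ?A a (brk ?A b c)) (brk ?A a (brk ?A a a)) (brk ?A b (brk ?A c a)))
        (brk ?A b (brk ?A b b)) (brk ?A c (brk ?A a b))" for a b c
  proof -
    \<comment> \<open>The Jacobi identity, solved for one term so that it can be used for rewriting.\<close>
    have J: "lie c (lie a b) = - lie a (lie b c) - lie b (lie c a)"
      using lie_algebra_identities(4)[OF L, of a b c] by (simp add: algebra_simps eq_neg_iff_add_eq_0)
    show ?thesis
      by (simp add: affgebra_of_simps lin B self kappa0 compat J skew[of _ "lam _"] algebra_simps)
  qed
  ultimately show ?thesis
    unfolding lie_affgebra_def
    using vector_space_is_affine_space[OF vector_space_axioms] affgebra_of_underlying_affine_space(1)
    by blast
qed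

section \<open>Cocycle conditions on a bi-affine form\<close>

text \<open>The bracket of the extension has \<open>\<omega>\<close> of the base points as its central component, so the
  central components of the antisymmetry and Jacobi identities are the two conditions on \<open>\<omega>\<close>.\<close>

lemma cocycle_conditions_of_lie_affgebra_extension:
  assumes "lie_affgebra (affgebra_extension A \<omega>)"
  shows "affgebra_cocycle_conditions A \<omega>"
proof -
  let ?E = "affgebra_extension A \<omega>"
  have t: "snd (tern ?E x y z) = snd x - snd y + snd z" for x y z
    by (simp add: affgebra_extension_def product_affine_def field_affine_def
        affine_of_vector_space_def affine_space.defs affgebra.defs split: prod.split)
  have b: "snd (brk ?E x y) = \<omega> (fst x) (fst y)" "fst (brk ?E x y) = brk A (fst x) (fst y)" for x y
    by (simp_all add: affgebra_extension_def affine_space.defs affgebra.defs split: prod.split)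
  from assms have
    1: "brk ?E y y = tern ?E (brk ?E x y) (brk ?E x x) (brk ?E y x)" and
    2: "brk ?E z (brk ?E z z) =
      tern ?E (tern ?E (brk ?E x (brk ?E y z)) (brk ?E x (brk ?E x x)) (brk ?E y (brk ?E z x)))
        (brk ?E y (brk ?E y y)) (brk ?E z (brk ?E x y))" for x y z
    unfolding lie_affgebra_def by blast+
  show ?thesis
    unfolding affgebra_cocycle_conditions_def
  proof (intro conjI allI)
    fix a b
    show "\<omega> a b - \<omega> a a + \<omega> b a = \<omega> b b"
      using arg_cong[OF 1[of "(b, 0)" "(a, 0)"], of snd] by (simp add: t b)
  next
    fix a b c
    show "\<omega> a (brk A b c) - \<omega> a (brk A a a) + \<omega> b (brk A c a) - \<omega> b (brk A b b)
       + \<omega> c (brk A a b) = \<omega> c (brk A c c)"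
      using arg_cong[OF 2[of "(c, 0)" "(a, 0)" "(b, 0)"], of snd] by (simp add: t b)
  qed
qed

text \<open>The cyclic identity \<open>c2\<close> is the second condition after the terms of degree at most one have
  cancelled. Its right-hand side depends on one variable at a time, \<open>F\<close> on two, and
  \<open>\<pi> a (lie b c)\<close> on three; specializing variables to \<open>0\<close> isolates each group.\<close>

lemma cocycle_decomposition_of_cocycle_conditions:
  fixes smul :: "'f::field \<Rightarrow> 'a::ab_group_add \<Rightarrow> 'a"
  assumes data: "lie_affgebra_data smul lie \<kappa> lam"
    and bil: "bilinear_map smul (*) \<pi>"
    and r: "linear_form smul \<rho>" and sg: "linear_form smul \<sigma>"
    and \<omega>: "\<And>a b. \<omega> a b = \<pi> a b + \<rho> a + \<sigma> b + \<tau>"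
    and cond: "affgebra_cocycle_conditions (affgebra_of smul lie \<kappa> lam s) \<omega>"
  shows "cocycle_decomposition smul lie lam (\<lambda>a. lam a - \<kappa> a) \<omega> \<pi> \<rho> \<sigma> \<tau>"
proof -
  have L: "lie_algebra smul lie" and K: "Vector_Spaces.linear smul smul \<kappa>"
    and M: "Vector_Spaces.linear smul smul lam"
    using data by (auto simp: lie_affgebra_data_def)
  note B = bilinear_map_simps[OF lie_algebra_identities(2)[OF L]] bilinear_map_simps[OF bil]
  note lin = linear_map_simps[OF K] linear_map_simps[OF M]
    linear_map_simps[OF r[unfolded linear_form_def]]
    linear_map_simps[OF sg[unfolded linear_form_def]]
  have c1: "\<omega> a b - \<omega> a a + \<omega> b a = \<omega> b b" for a b
    using cond by (simp add: affgebra_cocycle_conditions_def)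
  have self: "\<pi> a a = 0" for a
    using c1[of a 0] by (simp add: \<omega> B lin)
  have skew: "\<pi> b a = - \<pi> a b" for a b
    using c1[of a b] by (simp add: \<omega> self algebra_simps eq_neg_iff_add_eq_0)
  define F where "F a b = \<sigma> (lie a b) - \<pi> a (lam b - \<kappa> b) - \<pi> (lam a) b" for a b
  have c2: "\<pi> a (lie b c) + \<pi> b (lie c a) + \<pi> c (lie a b) + F a b + F b c + F c a
      = \<pi> a (\<kappa> a) + \<pi> b (\<kappa> b) + \<pi> c (\<kappa> c)" for a b c
  proof -
    have "\<omega> a (lie b c + \<kappa> b + lam (c - b) + s) - \<omega> a (lie a a + \<kappa> a + lam (a - a) + s)
      + \<omega> b (lie c a + \<kappa> c + lam (a - c) + s) - \<omega> b (lie b b + \<kappa> b + lam (b - b) + s)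
      + \<omega> c (lie a b + \<kappa> a + lam (b - a) + s) = \<omega> c (lie c c + \<kappa> c + lam (c - c) + s)"
      using cond by (simp only: affgebra_cocycle_conditions_def affgebra_of_simps)
    then show ?thesis
      unfolding F_def
      by (simp add: \<omega> B lin lie_algebra_identities(3)[OF L] skew[of _ "lam _"] algebra_simps)
  qed
  have F0: "F a 0 = 0" "F 0 a = 0" for a
    by (simp_all add: F_def B lin)
  have kappa0: "\<pi> a (\<kappa> a) = 0" for a
    using c2[of a 0 0] by (simp add: F0 B lin)
  have F: "F a b = 0" for a b
    using c2[of a b 0] by (simp add: F0 B lin kappa0)
  have "\<pi> a (lie b c) + \<pi> b (lie c a) + \<pi> c (lie a b) = 0" for a b c
    using c2[of a b c] by (simp add: F kappa0)
  moreover have "\<sigma> (lie a b) = \<pi> a (lam b - \<kappa> b) + \<pi> (lam a) b" for a b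
    using F[of a b] by (simp add: F_def algebra_simps)
  ultimately show ?thesis
    using bil r sg \<omega> skew unfolding cocycle_decomposition_def two_cocycle_def by blast
qed

section \<open>The central extension\<close>

lemma vector_space_central_scale:
  assumes "vector_space smul"
  shows "vector_space (central_scale smul)"
proof -
  interpret vector_space_prod smul "(*)"
    by (intro vector_space_prod.intro vector_space_pair.intro assms field_vector_space)
  show ?thesis
    unfolding central_scale_def by (rule p.vector_space_axioms)
qed

lemma central_scale_Pair:
  assumes "vector_space smul"
  shows "central_scale smul c (a, \<alpha>) = (smul c a, c * \<alpha>)"
proof -
  interpret vector_space_prod smul "(*)"
    by (intro vector_space_prod.intro vector_space_pair.intro assms field_vector_space)
  show ?thesis
    unfolding central_scale_def by (rule scale_prod)
qed

lemma lie_algebra_central_extension: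
  fixes smul :: "'f::field \<Rightarrow> 'a::ab_group_add \<Rightarrow> 'a"
  assumes char: "(2::'f) \<noteq> 0" and L: "lie_algebra smul lie" and \<pi>: "two_cocycle smul lie \<pi>"
  shows "lie_algebra (central_scale smul) (central_lie lie \<pi>)"
proof -
  note V = vector_space_central_scale[OF lie_algebra_identities(1)[OF L]]
  note scale = central_scale_Pair[OF lie_algebra_identities(1)[OF L]]
  have bil: "bilinear_map smul (*) \<pi>" and skew: "\<And>a b. \<pi> b a = - \<pi> a b"
    and coc: "\<And>a b c. \<pi> a (lie b c) + \<pi> b (lie c a) + \<pi> c (lie a b) = 0"
    using \<pi> unfolding two_cocycle_def by blast+
  note B = bilinear_map_simps[OF lie_algebra_identities(2)[OF L]] bilinear_map_simps[OF bil]
  have "2 * \<pi> a a = 0" for a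
    using skew[of a a] by (simp only: mult_2 eq_neg_iff_add_eq_0)
  then have self: "\<pi> a a = 0" for a using char by simp
  have "bilinear_map (central_scale smul) (central_scale smul) (central_lie lie \<pi>)"
    by (auto simp: bilinear_map_def Vector_Spaces.linear_iff V central_lie_def
        scale B split: prod.splits)
  moreover have "central_lie lie \<pi> x x = 0" for x
    by (simp add: central_lie_def self lie_algebra_identities(3)[OF L] zero_prod_def split: prod.split)
  moreover have "central_lie lie \<pi> x (central_lie lie \<pi> y z)
      + central_lie lie \<pi> y (central_lie lie \<pi> z x)
      + central_lie lie \<pi> z (central_lie lie \<pi> x y) = 0" for x y z
    by (simp add: central_lie_def coc lie_algebra_identities(4)[OF L] zero_prod_def split: prod.split)
  ultimately show ?thesis
    using V by (simp add: lie_algebra_def lie_algebra_axioms_def)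
qed

text \<open>In the central component, compatibility of the extended maps with the bracket is exactly the
  equation for \<open>\<sigma> (lie a b)\<close>, since brackets in \<open>\<gg>(\<pi>)\<close> depend only on the components in \<open>\<gg>\<close>.\<close>

lemma lie_affgebra_data_central_extension:
  fixes smul :: "'f::field \<Rightarrow> 'a::ab_group_add \<Rightarrow> 'a"
  assumes char: "(2::'f) \<noteq> 0" and data: "lie_affgebra_data smul lie \<kappa> lam"
    and \<pi>: "two_cocycle smul lie \<pi>" and r: "linear_form smul \<rho>" and sg: "linear_form smul \<sigma>"
    and sigma_lie: "\<And>a b. \<sigma> (lie a b) = \<pi> a (lam b - \<kappa> b) + \<pi> (lam a) b"
  shows "lie_affgebra_data (central_scale smul) (central_lie lie \<pi>)
    (\<lambda>(a, \<alpha>). (\<kappa> a, \<rho> a + \<sigma> a)) (\<lambda>(a, \<alpha>). (lam a, \<sigma> a))"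
proof -
  have L: "lie_algebra smul lie" and K: "Vector_Spaces.linear smul smul \<kappa>"
    and M: "Vector_Spaces.linear smul smul lam"
    and compat: "\<And>a b. lam (lie a b) = lie (lam a) b - lie a (\<kappa> b) + lie a (lam b)"
    using data by (auto simp: lie_affgebra_data_def)
  note V = vector_space_central_scale[OF lie_algebra_identities(1)[OF L]]
  note scale = central_scale_Pair[OF lie_algebra_identities(1)[OF L]]
  have bil: "bilinear_map smul (*) \<pi>" using \<pi> by (simp add: two_cocycle_def)
  note B = bilinear_map_simps[OF bil]
  note lin = linear_map_simps[OF K] linear_map_simps[OF M]
    linear_map_simps[OF r[unfolded linear_form_def]]
    linear_map_simps[OF sg[unfolded linear_form_def]]
  show ?thesis
    unfolding lie_affgebra_data_def Vector_Spaces.linear_iff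
    using lie_algebra_central_extension[OF char L \<pi>]
    by (auto simp: V scale central_lie_def lin compat sigma_lie B algebra_simps)
qed

text \<open>The bracket on the right has central component
  \<open>\<pi> a b + (\<rho> a + \<sigma> a) + \<sigma> (b - a) + \<tau>\<close>, so the \<open>\<sigma> a\<close> in the extension of \<open>\<kappa>\<close> makes up for
  the \<open>- \<sigma> a\<close> that comes from the extension of \<open>lam\<close>, and \<open>\<omega> a b\<close> remains.\<close>

lemma affgebra_extension_eq_affgebra_of_central_extension:
  assumes V: "vector_space smul" and sg: "linear_form smul \<sigma>"
    and \<omega>: "\<And>a b. \<omega> a b = \<pi> a b + \<rho> a + \<sigma> b + \<tau>"
  shows "affgebra_extension (affgebra_of smul lie \<kappa> lam s) \<omega> =
    affgebra_of (central_scale smul) (central_lie lie \<pi>)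
      (\<lambda>(a, \<alpha>). (\<kappa> a, \<rho> a + \<sigma> a)) (\<lambda>(a, \<alpha>). (lam a, \<sigma> a)) (s, \<tau>)"
proof -
  note lin = linear_map_simps[OF sg[unfolded linear_form_def]]
  show ?thesis
    by (auto simp: affgebra_extension_def affgebra_of_def product_affine_def field_affine_def
        affine_of_vector_space_def affine_space.defs affgebra.defs central_scale_Pair[OF V]
        central_lie_def \<omega> lin fun_eq_iff algebra_simps)
qed

lemma lie_affgebra_isomorphic_refl:
  "lie_affgebra A \<Longrightarrow> lie_affgebra_isomorphic A A"
  unfolding lie_affgebra_isomorphic_def affgebra_hom_def affine_map_def
  by (auto intro!: exI[of _ "\<lambda>x. x"] bij_id[unfolded id_def])

theorem proposition6p2:
  fixes smul :: "'f::field \<Rightarrow> 'a::ab_group_add \<Rightarrow> 'a"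
    and lie :: "'a \<Rightarrow> 'a \<Rightarrow> 'a"
    and \<kappa> lam \<delta> :: "'a \<Rightarrow> 'a"
    and s :: 'a
    and A :: "('f, 'a) affgebra"
    and \<omega> :: "'a \<Rightarrow> 'a \<Rightarrow> 'f"
  assumes char_not_2: "(2::'f) \<noteq> 0"
    and data: "lie_affgebra_data smul lie \<kappa> lam"
    and A: "A = affgebra_of smul lie \<kappa> lam s"
    and delta: "\<delta> = (\<lambda>a. lam a - \<kappa> a)"
    and biaffine: "biaffine_map A field_affine \<omega>"
  shows "(affgebra_cocycle_conditions A \<omega> \<longleftrightarrow>
            (\<exists>\<pi> \<rho> \<sigma> \<tau>. cocycle_decomposition smul lie lam \<delta> \<omega> \<pi> \<rho> \<sigma> \<tau>)) \<and>
         (\<forall>\<pi> \<rho> \<sigma> \<tau>. cocycle_decomposition smul lie lam \<delta> \<omega> \<pi> \<rho> \<sigma> \<tau> \<longrightarrow>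
            (let \<kappa>' = (\<lambda>(a, \<alpha>). (\<kappa> a, \<rho> a + \<sigma> a));
                 lam' = (\<lambda>(a, \<alpha>). (lam a, \<sigma> a));
                 s' = (s, \<tau>)
             in lie_affgebra_data (central_scale smul) (central_lie lie \<pi>) \<kappa>' lam' \<and>
                lie_affgebra_isomorphic (affgebra_extension A \<omega>)
                  (affgebra_of (central_scale smul) (central_lie lie \<pi>) \<kappa>' lam' s')))"
proof -
  have V: "vector_space smul"
    using data by (auto simp: lie_affgebra_data_def intro: lie_algebra_identities(1))
  have central: "lie_affgebra_data (central_scale smul) (central_lie lie \<pi>)
        (\<lambda>(a, \<alpha>). (\<kappa> a, \<rho> a + \<sigma> a)) (\<lambda>(a, \<alpha>). (lam a, \<sigma> a))"
    "affgebra_extension A \<omega> = affgebra_of (central_scale smul) (central_lie lie \<pi>)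
        (\<lambda>(a, \<alpha>). (\<kappa> a, \<rho> a + \<sigma> a)) (\<lambda>(a, \<alpha>). (lam a, \<sigma> a)) (s, \<tau>)"
    "lie_affgebra (affgebra_extension A \<omega>)"
    if "cocycle_decomposition smul lie lam \<delta> \<omega> \<pi> \<rho> \<sigma> \<tau>" for \<pi> \<rho> \<sigma> \<tau>
  proof -
    show data': "lie_affgebra_data (central_scale smul) (central_lie lie \<pi>)
        (\<lambda>(a, \<alpha>). (\<kappa> a, \<rho> a + \<sigma> a)) (\<lambda>(a, \<alpha>). (lam a, \<sigma> a))"
      using that unfolding delta cocycle_decomposition_def
      by (intro lie_affgebra_data_central_extension[OF char_not_2 data]) blast+
    show eq: "affgebra_extension A \<omega> = affgebra_of (central_scale smul) (central_lie lie \<pi>)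
        (\<lambda>(a, \<alpha>). (\<kappa> a, \<rho> a + \<sigma> a)) (\<lambda>(a, \<alpha>). (lam a, \<sigma> a)) (s, \<tau>)"
      using that unfolding A cocycle_decomposition_def
      by (intro affgebra_extension_eq_affgebra_of_central_extension[OF V]) blast+
    show "lie_affgebra (affgebra_extension A \<omega>)"
      unfolding eq by (rule lie_affgebra_affgebra_of[OF data'])
  qed
  have "\<exists>\<pi> \<rho> \<sigma> \<tau>. cocycle_decomposition smul lie lam \<delta> \<omega> \<pi> \<rho> \<sigma> \<tau>"
    if cond: "affgebra_cocycle_conditions A \<omega>"
  proof -
    obtain \<pi> \<rho> \<sigma> \<tau> where "bilinear_map smul (*) \<pi>" "linear_form smul \<rho>" "linear_form smul \<sigma>"
      "\<And>a b. \<omega> a b = \<pi> a b + \<rho> a + \<sigma> b + \<tau>"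
      using biaffine_form_decomposition[OF V biaffine[unfolded A affgebra_of_underlying_affine_space]]
      by metis
    from cocycle_decomposition_of_cocycle_conditions[OF data this cond[unfolded A]]
    show ?thesis unfolding delta by blast
  qed
  moreover have "affgebra_cocycle_conditions A \<omega>"
    if "cocycle_decomposition smul lie lam \<delta> \<omega> \<pi> \<rho> \<sigma> \<tau>" for \<pi> \<rho> \<sigma> \<tau>
    using cocycle_conditions_of_lie_affgebra_extension central(3)[OF that] .
  moreover have "lie_affgebra_isomorphic (affgebra_extension A \<omega>)
      (affgebra_of (central_scale smul) (central_lie lie \<pi>)
        (\<lambda>(a, \<alpha>). (\<kappa> a, \<rho> a + \<sigma> a)) (\<lambda>(a, \<alpha>). (lam a, \<sigma> a)) (s, \<tau>))"
    if "cocycle_decomposition smul lie lam \<delta> \<omega> \<pi> \<rho> \<sigma> \<tau>" for \<pi> \<rho> \<sigma> \<tau>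
    using lie_affgebra_isomorphic_refl[OF central(3)[OF that]] central(2)[OF that] by simp
  ultimately show ?thesis
    using central(1) by (simp add: Let_def) blast
qed

end
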